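(* For $0<\varepsilon<1$ let $$f_{\varepsilon,1-\varepsilon}(t)=\varepsilon t\log t-(\varepsilon t+1-\varepsilon)\log(\varepsilon t+1-\varepsilon),\quad t>0,$$ and let $w_{\varepsilon,1-\varepsilon}(\lambda)=\varepsilon\lambda$ for $0\le\lambda\le1-\varepsilon$ and $w_{\varepsilon,1-\varepsilon}(\lambda)=(1-\varepsilon)(1-\lambda)$ for $1-\varepsilon\le\lambda\le1$. Then $$\lim_{\varepsilon\downarrow0}\frac{f_{\varepsilon,1-\varepsilon}(t)}{\varepsilon}=t\log t-t+1\qquad(t>0),$$ and $$\left\|\frac{w_{\varepsilon,1-\varepsilon}(\lambda)}{\varepsilon}-\lambda\right\|_{L^1(0,1)}=\frac\varepsilon2 .$$ Thus the normalized density $w_{\varepsilon,1-\varepsilon}/\varepsilon$ converges in $L^1(0,1)$ to $\lambda\mapsto\lambda$ as $\varepsilon\downarrow0$.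
   Context: Logarithms are natural. The $L^1$ norm is with respect to Lebesgue measure in $\lambda\in(0,1)$. *)

theory Defs
  imports "HOL-Analysis.Analysis"
begin

definition f_eps :: "real \<Rightarrow> real \<Rightarrow> real" where
  "f_eps \<epsilon> t = \<epsilon> * t * ln t - (\<epsilon> * t + 1 - \<epsilon>) * ln (\<epsilon> * t + 1 - \<epsilon>)"

text \<open>Only the values for \<open>0 \<le> x \<le> 1\<close> are meaningful. The two formulas agree at
  \<open>x = 1 - \<epsilon>\<close>.\<close>

definition w_eps :: "real \<Rightarrow> real \<Rightarrow> real" where
  "w_eps \<epsilon> x = (if x \<le> 1 - \<epsilon> then \<epsilon> * x else (1 - \<epsilon>) * (1 - x))"

text \<open>The Bochner integral of a non-integrable function is \<open>0\<close>, so \<open>L1_norm\<close> is to be read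
  together with integrability of its argument.\<close>

definition L1_norm :: "'a measure \<Rightarrow> ('a \<Rightarrow> real) \<Rightarrow> real" where
  "L1_norm M g = (LINT x|M. \<bar>g x\<bar>)"

definition tendsto_L1 ::
  "'a measure \<Rightarrow> ('b \<Rightarrow> 'a \<Rightarrow> real) \<Rightarrow> ('a \<Rightarrow> real) \<Rightarrow> 'b filter \<Rightarrow> bool" where
  "tendsto_L1 M g h F \<longleftrightarrow>
     integrable M h \<and> (\<forall>\<^sub>F i in F. integrable M (g i)) \<and>
     ((\<lambda>i. L1_norm M (\<lambda>x. g i x - h x)) \<longlongrightarrow> 0) F"

end

(* The limit of f_eps is the derivative of \<epsilon> \<mapsto> f_eps \<epsilon> t at \<epsilon> = 0, where f_eps vanishes.
   For the norm, w_eps \<epsilon> x / \<epsilon> falls short of x exactly by the positive part of x - (1 - \<epsilon>)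
   divided by \<epsilon>, whose graph over (0, 1) bounds a right triangle with legs \<epsilon> and 1. *)
theory Submission
  imports Defs
begin

lemma tendsto_f_eps:
  assumes "t > 0"
  shows "((\<lambda>\<epsilon>. f_eps \<epsilon> t / \<epsilon>) \<longlongrightarrow> t * ln t - t + 1) (at_right 0)"
proof -
  \<comment> \<open>The argument \<open>\<epsilon> * t + 1 - \<epsilon>\<close> equals 1 at 0, so
    the second product has derivative \<open>(t - 1) * (ln 1 + 1)\<close>, that is
    \<open>t - 1\<close>.\<close>
  have "((\<lambda>\<epsilon>. f_eps \<epsilon> t) has_field_derivative t * ln t - t + 1) (at 0)"
    unfolding f_eps_def by (auto intro!: derivative_eq_intros)
  then have "((\<lambda>\<epsilon>. f_eps \<epsilon> t / \<epsilon>) \<longlongrightarrow> t * ln t - t + 1) (at 0)"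
    by (simp add: has_field_derivative_iff f_eps_def)
  then show ?thesis
    by (rule tendsto_mono[rotated]) (simp add: at_le)
qed

text \<open>Continuity is assumed up to the endpoints: compactness then gives integrability on the
  closed interval, which is inherited by the open one.\<close>

lemma integrable_lebesgue_on_open_interval:
  fixes g :: "real \<Rightarrow> real"
  assumes "continuous_on {a..b} g"
  shows "integrable (lebesgue_on {a<..<b}) g"
proof -
  have "integrable (lebesgue_on {a..b}) g"
    using assms by (rule continuous_imp_integrable_real)
  then have "set_integrable lebesgue {a..b} g"
    by (simp add: integrable_restrict_space set_integrable_def)
  then have "set_integrable lebesgue {a<..<b} g"
    by (rule set_integrable_subset) auto
  then show ?thesis
    by (simp add: integrable_restrict_space set_integrable_def)
qed

text \<open>On the second branch \<open>(1 - \<epsilon>) * (1 - x) = \<epsilon> * x - (x - (1 -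
  \<epsilon>))\<close>. Writing the case split as a \<open>max\<close> makes continuity in
  \<open>x\<close> evident.\<close>

lemma w_eps_div_eq:
  assumes "0 < \<epsilon>"
  shows "w_eps \<epsilon> x / \<epsilon> = x - max 0 (x - (1 - \<epsilon>)) / \<epsilon>"
  using assms by (auto simp: w_eps_def max_def field_simps)

lemma L1_norm_w_eps:
  assumes "0 < \<epsilon>" "\<epsilon> < 1"
  shows "L1_norm (lebesgue_on {0<..<1}) (\<lambda>x. w_eps \<epsilon> x / \<epsilon> - x) = \<epsilon> / 2"
proof -
  define g where "g x = max 0 (x - (1 - \<epsilon>)) / \<epsilon>" for x
  have int: "integrable (lebesgue_on {0<..<1}) g"
    unfolding g_def using assms
    by (intro integrable_lebesgue_on_open_interval continuous_intros) auto
  \<comment> \<open>The integral is split at the kink \<open>1 - \<epsilon>\<close>, so that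
    \<open>g\<close> is affine on each piece.\<close>
  have "(g has_integral 0) {0..1 - \<epsilon>}"
    by (rule has_integral_eq[where f = "\<lambda>_. 0"]) (auto simp: g_def)
  moreover have "(g has_integral \<epsilon> / 2) {1 - \<epsilon>..1}"
  proof (rule has_integral_eq)
    \<comment> \<open>The value is left unsimplified to display the antiderivative
      \<open>(x - (1 - \<epsilon>))\<^sup>2 / (2 * \<epsilon>)\<close> at both endpoints.\<close>
    have "((\<lambda>x. (x - (1 - \<epsilon>)) / \<epsilon>) has_integral
        (1 - (1 - \<epsilon>))\<^sup>2 / (2 * \<epsilon>) - ((1 - \<epsilon>) - (1 - \<epsilon>))\<^sup>2 / (2 * \<epsilon>)) {1 - \<epsilon>..1}"
      using assms
      by (intro fundamental_theorem_of_calculus)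
        (auto intro!: derivative_eq_intros simp: has_real_derivative_iff_has_vector_derivative[symmetric] field_simps)
    then show "((\<lambda>x. (x - (1 - \<epsilon>)) / \<epsilon>) has_integral \<epsilon> / 2) {1 - \<epsilon>..1}"
      using assms by (simp add: power2_eq_square)
  qed (auto simp: g_def)
  ultimately have "(g has_integral 0 + \<epsilon> / 2) {0..1}"
    using assms by (intro has_integral_combine[where c = "1 - \<epsilon>"]) auto
  then have "integral {0<..<1} g = \<epsilon> / 2"
    by (simp add: integral_unique flip: integral_open_interval_real)
  \<comment> \<open>Integrability of \<open>g\<close> allows the gauge integral to be read as a
    Lebesgue integral.\<close>
  then have "(LINT x|lebesgue_on {0<..<1}. g x) = \<epsilon> / 2"
    using int by (simp add: lebesgue_integral_eq_integral)
  moreover have "\<bar>w_eps \<epsilon> x / \<epsilon> - x\<bar> = g x" for x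
    using assms by (simp add: w_eps_div_eq g_def)
  ultimately show ?thesis
    by (simp add: L1_norm_def)
qed

lemma integrable_w_eps_div:
  assumes "0 < \<epsilon>"
  shows "integrable (lebesgue_on {0<..<1}) (\<lambda>x. w_eps \<epsilon> x / \<epsilon>)"
  unfolding w_eps_div_eq[OF assms] using assms
  by (intro integrable_lebesgue_on_open_interval continuous_intros) auto

lemma integrable_ident_unit_interval: "integrable (lebesgue_on {0<..<1}) (\<lambda>x::real. x)"
  by (intro integrable_lebesgue_on_open_interval continuous_intros)

lemma tendsto_L1_w_eps:
  "tendsto_L1 (lebesgue_on {0<..<1}) (\<lambda>\<epsilon> x. w_eps \<epsilon> x / \<epsilon>) (\<lambda>x. x) (at_right 0)"
  unfolding tendsto_L1_def
proof (intro conjI integrable_ident_unit_interval)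
  show "\<forall>\<^sub>F \<epsilon> in at_right 0. integrable (lebesgue_on {0<..<1}) (\<lambda>x. w_eps \<epsilon> x / \<epsilon>)"
    using eventually_at_right_less[of "0::real"]
    by (rule eventually_mono) (rule integrable_w_eps_div)
  have "((\<lambda>\<epsilon>::real. \<epsilon> / 2) \<longlongrightarrow> 0) (at_right 0)"
    by (auto intro!: tendsto_eq_intros)
  moreover have "\<forall>\<^sub>F \<epsilon> in at_right 0.
      L1_norm (lebesgue_on {0<..<1}) (\<lambda>x. w_eps \<epsilon> x / \<epsilon> - x) = \<epsilon> / 2"
    \<comment> \<open>The exact norm is known only for \<epsilon> in (0, 1), which holds eventually
      to the right of 0.\<close>
    using eventually_at_right_real[of 0 1]
    by (rule eventually_mono) (simp_all add: L1_norm_w_eps)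
  ultimately show
    "((\<lambda>\<epsilon>. L1_norm (lebesgue_on {0<..<1}) (\<lambda>x. w_eps \<epsilon> x / \<epsilon> - x)) \<longlongrightarrow> 0) (at_right 0)"
    by (simp only: tendsto_cong)
qed

theorem proposition11p7:
  "(\<forall>t>0. ((\<lambda>\<epsilon>. f_eps \<epsilon> t / \<epsilon>) \<longlongrightarrow> t * ln t - t + 1) (at_right 0)) \<and>
   (\<forall>\<epsilon>. 0 < \<epsilon> \<and> \<epsilon> < 1 \<longrightarrow>
      integrable (lebesgue_on {0<..<1}) (\<lambda>x. w_eps \<epsilon> x / \<epsilon> - x) \<and>
      L1_norm (lebesgue_on {0<..<1}) (\<lambda>x. w_eps \<epsilon> x / \<epsilon> - x) = \<epsilon> / 2) \<and>
   tendsto_L1 (lebesgue_on {0<..<1}) (\<lambda>\<epsilon> x. w_eps \<epsilon> x / \<epsilon>) (\<lambda>x. x) (at_right 0)"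
  \<comment> \<open>The difference inherits integrability from its two terms, so its norm is a
    genuine integral and not a default value.\<close>
  using tendsto_f_eps L1_norm_w_eps tendsto_L1_w_eps
    Bochner_Integration.integrable_diff[OF integrable_w_eps_div integrable_ident_unit_interval]
  by blast

end
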